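(* Let $\Gamma$ be a discrete polymatroid and let $>_\ell$ be a monomial order on the base ring of $\Gamma$. Suppose that the directed graph $\mathcal{G}^\ell(\mu)$ has a unique sink whenever it is nonempty. Then the toric ideal of $\Gamma$ is generated by symmetric exchange binomials, and the symmetric exchange binomials form a Gröbner basis of the toric ideal of $\Gamma$ with respect to $>_\ell$.
   Context: All monomials are in the variables $x_0,x_1,x_2,\ldots$; $d_i(m)$ denotes the degree of $x_i$ in $m$. A discrete polymatroid is a finite collection $\Gamma$ of monomials such that (1) if $m\in\Gamma$ and $m'\mid m$ then $m'\in\Gamma$, and (2) if $m,m'\in\Gamma$ and $\deg m>\deg m'$, there is $i$ with $d_i(m)>d_i(m')$ and $x_im'\in\Gamma$. Its maximal monomials (all of one degree $r$, the rank) are its bases. If $m,m'$ are bases and $d_i(m)>d_i(m')$, $d_j(m)<d_j(m')$ with $\frac{x_j}{x_i}m$ and $\frac{x_i}{x_j}m'$ both bases, these are obtained from $m,m'$ by a symmetric exchange. The base ring is $\mathbb{C}[Y_m: m\text{ a basis}]$; the toric ideal is the kernel of $\phi: Y_{m_1}\cdots Y_{m_t}\mapsto m_1\cdots m_t$ into $\mathbb{C}[x_0,x_1,\ldots]$. A symmetric exchange binomial is $Y_mY_{m'}-Y_nY_{n'}$ with $n,n'$ obtained from $m,m'$ by a symmetric exchange. A monomial order on the base ring is a total order on its monomials with $M>_\ell 1$ for $M\ne 1$ and $M>_\ell M'\Rightarrow MN>_\ell M'N$. For a collection (multiset) $V=\{m_1,\ldots,m_t\}$ of bases write $M_V=Y_{m_1}\cdots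 Y_{m_t}$. For a monomial $\mu$, $\mathcal{G}(\mu)$ is the simple graph whose vertices are the collections $V$ of bases with $m_1\cdots m_t=\mu$, with $V,W$ adjacent when $W$ arises from $V$ by a symmetric exchange on two of its bases (equivalently $M_V-M_W=NS$ for a monomial $N$ and symmetric exchange binomial $S$). $\mathcal{G}^\ell(\mu)$ is the directed graph with the same vertices and edges, each edge $\{V,W\}$ directed toward $W$ if $M_V>_\ell M_W$ and toward $V$ otherwise. *)

theory Defs
  imports
    Complex_Main
    "HOL-Library.Poly_Mapping"
    "HOL-Library.Multiset"
    "HOL-Algebra.Ideal"
begin

section \<open>Monomials and discrete polymatroids\<close>

text \<open>A monomial in indeterminates of type \<open>'v\<close> is its exponent vector, written additively:
  \<open>m + n\<close> is the product of monomials, \<open>0\<close> is the monomial 1,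
  \<open>lookup m i\<close> is the degree of the indeterminate \<open>i\<close> in \<open>m\<close>. Polynomials are finitely supported
  functions on monomials, with the convolution product of \<open>HOL-Library.Poly_Mapping\<close>.\<close>

type_synonym 'v monomial = "'v \<Rightarrow>\<^sub>0 nat"
type_synonym 'v cpoly = "'v monomial \<Rightarrow>\<^sub>0 complex"

abbreviation indet :: "'v \<Rightarrow> 'v monomial" where
  "indet v \<equiv> Poly_Mapping.single v 1"

abbreviation poly_monom :: "'v monomial \<Rightarrow> 'v cpoly" where
  "poly_monom m \<equiv> Poly_Mapping.single m 1"

definition mdeg :: "'v monomial \<Rightarrow> nat" where
  "mdeg m = (\<Sum>i\<in>Poly_Mapping.keys m. Poly_Mapping.lookup m i)"

definition mdivides :: "'v monomial \<Rightarrow> 'v monomial \<Rightarrow> bool" where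
  "mdivides m' m \<longleftrightarrow> (\<exists>k. m = m' + k)"

definition discrete_polymatroid :: "nat monomial set \<Rightarrow> bool" where
  "discrete_polymatroid \<Gamma> \<longleftrightarrow>
     finite \<Gamma> \<and>
     (\<forall>m\<in>\<Gamma>. \<forall>m'. mdivides m' m \<longrightarrow> m' \<in> \<Gamma>) \<and>
     (\<forall>m\<in>\<Gamma>. \<forall>m'\<in>\<Gamma>. mdeg m > mdeg m' \<longrightarrow>
        (\<exists>i. Poly_Mapping.lookup m i > Poly_Mapping.lookup m' i \<and> indet i + m' \<in> \<Gamma>))"

definition bases :: "nat monomial set \<Rightarrow> nat monomial set" where
  "bases \<Gamma> = {m\<in>\<Gamma>. \<forall>m'\<in>\<Gamma>. mdivides m m' \<longrightarrow> m' = m}"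

text \<open>\<open>n\<close> and \<open>n'\<close> are obtained from \<open>m\<close> and \<open>m'\<close> by a symmetric exchange. The equation
  \<open>n = (x\<^sub>j / x\<^sub>i) m\<close> is stated without division, as \<open>x\<^sub>i n = x\<^sub>j m\<close>; similarly for \<open>n'\<close>.\<close>

definition symmetric_exchange ::
  "nat monomial set \<Rightarrow> nat monomial \<Rightarrow> nat monomial \<Rightarrow> nat monomial \<Rightarrow> nat monomial \<Rightarrow> bool" where
  "symmetric_exchange \<Gamma> m m' n n' \<longleftrightarrow>
     m \<in> bases \<Gamma> \<and> m' \<in> bases \<Gamma> \<and> n \<in> bases \<Gamma> \<and> n' \<in> bases \<Gamma> \<and>
     (\<exists>i j. Poly_Mapping.lookup m i > Poly_Mapping.lookup m' i \<and>
            Poly_Mapping.lookup m j < Poly_Mapping.lookup m' j \<and>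
            indet i + n = indet j + m \<and> indet j + n' = indet i + m')"

section \<open>The base ring and the toric ideal\<close>

text \<open>The indeterminate \<open>Y\<^sub>m\<close> is indexed by the monomial \<open>m\<close> itself, so a polynomial in all the
  \<open>Y\<^sub>m\<close> has type \<open>nat monomial cpoly\<close>; the base ring consists of those that involve only
  bases.\<close>

definition base_monomials :: "nat monomial set \<Rightarrow> nat monomial monomial set" where
  "base_monomials \<Gamma> = {M. Poly_Mapping.keys M \<subseteq> bases \<Gamma>}"

definition base_ring :: "nat monomial set \<Rightarrow> nat monomial cpoly ring" where
  "base_ring \<Gamma> =
     \<lparr>carrier = {p. Poly_Mapping.keys p \<subseteq> base_monomials \<Gamma>},
      mult = (*), one = 1, zero = 0, add = (+)\<rparr>"

lemma base_monomials_closed: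
  "0 \<in> base_monomials \<Gamma>"
  "M \<in> base_monomials \<Gamma> \<Longrightarrow> N \<in> base_monomials \<Gamma> \<Longrightarrow> M + N \<in> base_monomials \<Gamma>"
  using Poly_Mapping.keys_add[of M N] by (auto simp: base_monomials_def)

text \<open>By the following lemma, \<open>Idl\<^bsub>base_ring \<Gamma>\<^esub>\<close> below is the generated ideal in the usual sense.\<close>

lemma cring_base_ring: "cring (base_ring \<Gamma>)"
proof -
  let ?C = "{p :: nat monomial cpoly. Poly_Mapping.keys p \<subseteq> base_monomials \<Gamma>}"
  have add: "p + q \<in> ?C" if "p \<in> ?C" "q \<in> ?C" for p q
    using that Poly_Mapping.keys_add[of p q] by blast
  have mult: "p * q \<in> ?C" if "p \<in> ?C" "q \<in> ?C" for p q
    using that Poly_Mapping.keys_mult[of p q] base_monomials_closed(2) by blast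
  have uminus: "- p \<in> ?C" if "p \<in> ?C" for p
  proof -
    have "Poly_Mapping.keys (- p) = Poly_Mapping.keys p"
      by (auto simp: in_keys_iff)
    thus ?thesis using that by simp
  qed
  show ?thesis
  proof (rule cringI)
    show "abelian_group (base_ring \<Gamma>)"
    proof (rule abelian_groupI)
      fix p assume "p \<in> carrier (base_ring \<Gamma>)"
      thus "\<exists>q\<in>carrier (base_ring \<Gamma>). q \<oplus>\<^bsub>base_ring \<Gamma>\<^esub> p = \<zero>\<^bsub>base_ring \<Gamma>\<^esub>"
        using uminus by (intro bexI[of _ "- p"]) (auto simp: base_ring_def)
    qed (use add in \<open>auto simp: base_ring_def add_ac\<close>)
    show "comm_monoid (base_ring \<Gamma>)"
      by (rule comm_monoidI)
        (use mult base_monomials_closed in \<open>auto simp: base_ring_def mult_ac\<close>)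
  qed (auto simp: base_ring_def distrib_right)
qed

definition toric_map :: "nat monomial cpoly \<Rightarrow> nat cpoly" where
  "toric_map p =
     (\<Sum>M\<in>Poly_Mapping.keys p. Poly_Mapping.single 0 (Poly_Mapping.lookup p M) *
        (\<Prod>m\<in>Poly_Mapping.keys M. poly_monom m ^ Poly_Mapping.lookup M m))"

definition toric_ideal :: "nat monomial set \<Rightarrow> nat monomial cpoly set" where
  "toric_ideal \<Gamma> = {p \<in> carrier (base_ring \<Gamma>). toric_map p = 0}"

definition exchange_binomials :: "nat monomial set \<Rightarrow> nat monomial cpoly set" where
  "exchange_binomials \<Gamma> =
     {poly_monom (indet m + indet m') - poly_monom (indet n + indet n') | m m' n n'.
        symmetric_exchange \<Gamma> m m' n n'}"

section \<open>Monomial orders and Groebner bases\<close>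

text \<open>\<open>gt M N\<close> stands for \<open>M >\<^sub>\<ell> N\<close>; only its restriction to the monomials of the base ring
  matters.\<close>

definition monomial_order ::
  "nat monomial set \<Rightarrow> (nat monomial monomial \<Rightarrow> nat monomial monomial \<Rightarrow> bool) \<Rightarrow> bool" where
  "monomial_order \<Gamma> gt \<longleftrightarrow>
     irreflp_on (base_monomials \<Gamma>) gt \<and>
     transp_on (base_monomials \<Gamma>) gt \<and>
     totalp_on (base_monomials \<Gamma>) gt \<and>
     (\<forall>M\<in>base_monomials \<Gamma>. M \<noteq> 0 \<longrightarrow> gt M 0) \<and>
     (\<forall>M\<in>base_monomials \<Gamma>. \<forall>M'\<in>base_monomials \<Gamma>. \<forall>N\<in>base_monomials \<Gamma>.
        gt M M' \<longrightarrow> gt (M + N) (M' + N))"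

text \<open>Meaningful only for \<open>p \<noteq> 0\<close>.\<close>

definition leading_monomial ::
  "('v monomial \<Rightarrow> 'v monomial \<Rightarrow> bool) \<Rightarrow> 'v cpoly \<Rightarrow> 'v monomial" where
  "leading_monomial gt p =
     (THE M. M \<in> Poly_Mapping.keys p \<and> (\<forall>N\<in>Poly_Mapping.keys p. N \<noteq> M \<longrightarrow> gt M N))"

definition initial_ideal ::
  "nat monomial set \<Rightarrow> (nat monomial monomial \<Rightarrow> nat monomial monomial \<Rightarrow> bool) \<Rightarrow>
     nat monomial cpoly set \<Rightarrow> nat monomial cpoly set" where
  "initial_ideal \<Gamma> gt F =
     Idl\<^bsub>base_ring \<Gamma>\<^esub> ((\<lambda>p. poly_monom (leading_monomial gt p)) ` (F - {0}))"

text \<open>A symmetric exchange may return the same two bases, so the zero polynomial can be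
  an exchange binomial; it contributes nothing to the initial ideal.\<close>

definition groebner_basis ::
  "nat monomial set \<Rightarrow> (nat monomial monomial \<Rightarrow> nat monomial monomial \<Rightarrow> bool) \<Rightarrow>
     nat monomial cpoly set \<Rightarrow> nat monomial cpoly set \<Rightarrow> bool" where
  "groebner_basis \<Gamma> gt I G \<longleftrightarrow>
     finite G \<and> G \<subseteq> I \<and> initial_ideal \<Gamma> gt G = initial_ideal \<Gamma> gt I"

section \<open>The exchange graphs\<close>

definition collection_monomial :: "nat monomial multiset \<Rightarrow> nat monomial monomial" where
  "collection_monomial V = (\<Sum>m\<in>#V. indet m)"

definition graph_vertices :: "nat monomial set \<Rightarrow> nat monomial \<Rightarrow> nat monomial multiset set" where
  "graph_vertices \<Gamma> \<mu> = {V. set_mset V \<subseteq> bases \<Gamma> \<and> \<Sum>\<^sub># V = \<mu>}"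

definition exchange_step ::
  "nat monomial set \<Rightarrow> nat monomial multiset \<Rightarrow> nat monomial multiset \<Rightarrow> bool" where
  "exchange_step \<Gamma> V W \<longleftrightarrow>
     (\<exists>U m m' n n'. symmetric_exchange \<Gamma> m m' n n' \<and>
        V = U + {#m, m'#} \<and> W = U + {#n, n'#})"

text \<open>The reverse of a symmetric exchange need not be one: \<open>x\<^sub>0\<^sup>2, x\<^sub>1\<^sup>2\<close> can be exchanged to
  \<open>x\<^sub>0x\<^sub>1, x\<^sub>0x\<^sub>1\<close>, but no exchange applies to two equal bases. Since the graph is undirected,
  adjacency is the symmetric closure; since it is simple, loops are excluded.\<close>

definition graph_adjacent ::
  "nat monomial set \<Rightarrow> nat monomial \<Rightarrow> nat monomial multiset \<Rightarrow> nat monomial multiset \<Rightarrow> bool" where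
  "graph_adjacent \<Gamma> \<mu> V W \<longleftrightarrow>
     V \<in> graph_vertices \<Gamma> \<mu> \<and> W \<in> graph_vertices \<Gamma> \<mu> \<and> V \<noteq> W \<and>
     (exchange_step \<Gamma> V W \<or> exchange_step \<Gamma> W V)"

definition digraph_arc ::
  "nat monomial set \<Rightarrow> (nat monomial monomial \<Rightarrow> nat monomial monomial \<Rightarrow> bool) \<Rightarrow>
     nat monomial \<Rightarrow> nat monomial multiset \<Rightarrow> nat monomial multiset \<Rightarrow> bool" where
  "digraph_arc \<Gamma> gt \<mu> V W \<longleftrightarrow>
     graph_adjacent \<Gamma> \<mu> V W \<and> gt (collection_monomial V) (collection_monomial W)"

definition digraph_sink ::
  "nat monomial set \<Rightarrow> (nat monomial monomial \<Rightarrow> nat monomial monomial \<Rightarrow> bool) \<Rightarrow>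
     nat monomial \<Rightarrow> nat monomial multiset \<Rightarrow> bool" where
  "digraph_sink \<Gamma> gt \<mu> V \<longleftrightarrow>
     V \<in> graph_vertices \<Gamma> \<mu> \<and> \<not> (\<exists>W. digraph_arc \<Gamma> gt \<mu> V W)"

end

theory Submission
  imports Defs
begin

text \<open>The toric ideal consists of the polynomials whose coefficients sum to zero over every fibre of
  the exponent map of \<open>\<phi>\<close>, and the monomials of such a fibre correspond to the vertices of
  \<open>\<G>(\<mu>)\<close>. Along an arc the monomial changes by a multiple of an exchange binomial and decreases.
  Hence every monomial reduces to that of the unique sink of its graph, and an element of the toric
  ideal reduces to zero. The leading monomial of a nonzero element shares its fibre with a smaller
  monomial, which reduces further to the sink; so it is not itself the sink, and the arc leaving it
  exhibits it as a multiple of the leading monomial of an exchange binomial.\<close>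

section \<open>Relabelling the exponents of a polynomial\<close>

text \<open>Coefficients are added up over the fibres of \<open>f\<close>. For additive
  \<open>f\<close> this is the induced homomorphism of monoid algebras; arbitrary \<open>f\<close>
  is allowed so that replacing each monomial by a normal form is also an instance.\<close>

definition push :: "('a \<Rightarrow> 'b) \<Rightarrow> ('a \<Rightarrow>\<^sub>0 'c) \<Rightarrow> ('b \<Rightarrow>\<^sub>0 'c::comm_monoid_add)" where
  "push f p = (\<Sum>M\<in>Poly_Mapping.keys p. Poly_Mapping.single (f M) (Poly_Mapping.lookup p M))"

lemma push_superset:
  assumes "finite A" "Poly_Mapping.keys p \<subseteq> A"
  shows "push f p = (\<Sum>M\<in>A. Poly_Mapping.single (f M) (Poly_Mapping.lookup p M))"
  unfolding push_def
  by (rule sum.mono_neutral_left) (use assms in \<open>auto simp: in_keys_iff\<close>)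

lemma push_0 [simp]: "push f 0 = 0"
  by (simp add: push_def)

lemma push_single [simp]: "push f (Poly_Mapping.single M c) = Poly_Mapping.single (f M) c"
  by (cases "c = 0") (auto simp: push_def)

lemma push_add: "push f (p + q) = push f p + push f q"
proof -
  let ?A = "Poly_Mapping.keys p \<union> Poly_Mapping.keys q"
  have "finite ?A" "Poly_Mapping.keys (p + q) \<subseteq> ?A"
    using Poly_Mapping.keys_add[of p q] by auto
  then show ?thesis
    by (simp add: push_superset[of ?A] lookup_add single_add sum.distrib)
qed

lemma push_sum: "push f (\<Sum>x\<in>A. g x) = (\<Sum>x\<in>A. push f (g x))"
  by (induction A rule: infinite_finite_induct) (simp_all add: push_add)

lemma push_uminus: "push f (- p :: _ \<Rightarrow>\<^sub>0 'c::ab_group_add) = - push f p"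
  by (rule minus_unique[symmetric]) (simp flip: push_add)

lemma push_diff: "push f (p - q :: _ \<Rightarrow>\<^sub>0 'c::ab_group_add) = push f p - push f q"
  using push_add[of f p "- q"] by (simp add: push_uminus)

text \<open>Functoriality: a polynomial killed by \<open>push f\<close> is killed by every
  relabelling that factors through \<open>f\<close>.\<close>

lemma push_push: "push g (push f p) = push (g \<circ> f) p"
  by (simp add: push_def[of f] push_sum) (simp add: push_def)

lemma push_id: "push (\<lambda>M. M) p = p"
proof (rule poly_mapping_eqI)
  fix k
  show "Poly_Mapping.lookup (push (\<lambda>M. M) p) k = Poly_Mapping.lookup p k"
    by (cases "k \<in> Poly_Mapping.keys p")
      (auto simp: push_def lookup_sum lookup_single when_def in_keys_iff sum.delta)
qed

lemma push_mult:
  fixes p q :: "'a::monoid_add \<Rightarrow>\<^sub>0 'c::semiring_0" and f :: "'a \<Rightarrow> 'b::monoid_add"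
  assumes "\<And>M N. f (M + N) = f M + f N"
  shows "push f (p * q) = push f p * push f q"
proof -
  \<comment> \<open>Through \<open>push_id\<close> both factors become finite sums of terms, and
    distributivity reduces the claim to \<open>mult_single\<close>.\<close>
  have "p * q = push (\<lambda>M. M) p * push (\<lambda>M. M) q"
    by (simp add: push_id)
  then show ?thesis
    by (simp add: push_def[of _ p] push_def[of _ q] sum_product push_sum mult_single assms)
qed

lemma lookup_push:
  "Poly_Mapping.lookup (push f p) k =
     (\<Sum>M\<in>{M\<in>Poly_Mapping.keys p. f M = k}. Poly_Mapping.lookup p M)"
  by (simp add: push_def lookup_sum lookup_single when_def sum.If_cases Int_def)

text \<open>Cancellation needs a partner: were \<open>M\<close> the only key in its fibre, its
  nonzero coefficient would survive as the coefficient of \<open>push f p\<close> at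
  \<open>f M\<close>.\<close>

lemma push_eq_0_other_key:
  assumes "push f p = 0" "M \<in> Poly_Mapping.keys p"
  obtains N where "N \<in> Poly_Mapping.keys p" "N \<noteq> M" "f N = f M"
proof (rule ccontr)
  assume "\<not> thesis"
  with that assms(2) have "{N\<in>Poly_Mapping.keys p. f N = f M} = {M}"
    by auto
  with lookup_push[of f p "f M"] assms show False
    by (simp add: in_keys_iff)
qed

section \<open>Collections and monomials\<close>

text \<open>The inverse of \<open>collection_monomial\<close>: an exponent vector has finite
  support, so it can serve directly as the count function of a multiset.\<close>

definition collection_of :: "'v monomial \<Rightarrow> 'v multiset" where
  "collection_of M = Abs_multiset (Poly_Mapping.lookup M)"

lemma count_collection_of [simp]: "count (collection_of M) = Poly_Mapping.lookup M"
proof -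
  have "finite {x. 0 < Poly_Mapping.lookup M x}"
    by (rule finite_subset[OF _ finite_keys[of M]]) (auto simp: in_keys_iff)
  then show ?thesis
    unfolding collection_of_def by (rule Abs_multiset_inverse[OF CollectI])
qed

lemma set_collection_of [simp]: "set_mset (collection_of M) = Poly_Mapping.keys M"
  by (auto simp: set_mset_def in_keys_iff)

lemma collection_of_add: "collection_of (M + N) = collection_of M + collection_of N"
  by (rule multiset_eqI) (simp add: lookup_add)

lemma lookup_collection_monomial [simp]:
  "Poly_Mapping.lookup (collection_monomial V) m = count V m"
  by (induction V) (auto simp: collection_monomial_def lookup_add lookup_single when_def)

lemma collection_monomial_collection_of [simp]: "collection_monomial (collection_of M) = M"
  by (rule poly_mapping_eqI) simp

lemma collection_of_collection_monomial [simp]: "collection_of (collection_monomial V) = V"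
  by (rule multiset_eqI) simp

lemma collection_monomial_eq_iff [simp]: "collection_monomial V = collection_monomial W \<longleftrightarrow> V = W"
  by (metis collection_of_collection_monomial)

lemma collection_monomial_add:
  "collection_monomial (V + W) = collection_monomial V + collection_monomial W"
  by (simp add: collection_monomial_def)

lemma collection_monomial_pair: "collection_monomial {#m, n#} = indet m + indet n"
  by (simp add: collection_monomial_def)

lemma collection_monomial_in_base_monomials:
  "collection_monomial V \<in> base_monomials \<Gamma> \<longleftrightarrow> set_mset V \<subseteq> bases \<Gamma>"
  by (metis base_monomials_def collection_of_collection_monomial mem_Collect_eq set_collection_of)

text \<open>The monoid homomorphism underlying \<open>\<phi>\<close>. Its fibre over
  \<open>\<mu>\<close> within \<open>base_monomials \<Gamma>\<close> corresponds to the vertex set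
  of \<G>(\<mu>).\<close>

definition toric_exponent :: "'v monomial monomial \<Rightarrow> 'v monomial" where
  "toric_exponent M = \<Sum>\<^sub># (collection_of M)"

lemma toric_exponent_add: "toric_exponent (M + N) = toric_exponent M + toric_exponent N"
  by (simp add: toric_exponent_def collection_of_add)

lemma toric_exponent_collection_monomial [simp]:
  "toric_exponent (collection_monomial V) = \<Sum>\<^sub># V"
  by (simp add: toric_exponent_def)

lemma collection_of_in_graph_vertices:
  "collection_of M \<in> graph_vertices \<Gamma> \<mu> \<longleftrightarrow> M \<in> base_monomials \<Gamma> \<and> toric_exponent M = \<mu>"
  by (simp add: graph_vertices_def base_monomials_def toric_exponent_def)

text \<open>\<open>poly_monom\<close> turns sums of exponents into products, so a monomial is mapped
  to a single monomial. The toric ideal thereby becomes the kernel of a \<open>push\<close>.\<close>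

lemma toric_map_eq_push: "toric_map p = push toric_exponent p"
proof -
  have "(\<Prod>m\<in>Poly_Mapping.keys M. poly_monom m ^ Poly_Mapping.lookup M m)
      = poly_monom (toric_exponent M)" for M :: "nat monomial monomial"
  proof -
    have "(\<Prod>m\<in>#V. poly_monom m) = poly_monom (\<Sum>\<^sub># V)" for V :: "nat monomial multiset"
      by (induction V) (simp_all add: mult_single)
    from this[of "collection_of M"] show ?thesis
      by (simp add: toric_exponent_def image_prod_mset_multiplicity)
  qed
  then show ?thesis
    by (simp add: toric_map_def push_def mult_single)
qed

section \<open>Ideals of the base ring\<close>

lemma base_ring_simps [simp]:
  "p \<in> carrier (base_ring \<Gamma>) \<longleftrightarrow> Poly_Mapping.keys p \<subseteq> base_monomials \<Gamma>"
  "p \<oplus>\<^bsub>base_ring \<Gamma>\<^esub> q = p + q" "p \<otimes>\<^bsub>base_ring \<Gamma>\<^esub> q = p * q"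
  "\<zero>\<^bsub>base_ring \<Gamma>\<^esub> = 0" "\<one>\<^bsub>base_ring \<Gamma>\<^esub> = 1"
  by (simp_all add: base_ring_def)

lemma ring_base_ring: "ring (base_ring \<Gamma>)"
  using cring_base_ring cring.axioms(1) by blast

lemma single_in_base_ring:
  "M \<in> base_monomials \<Gamma> \<Longrightarrow> Poly_Mapping.single M c \<in> carrier (base_ring \<Gamma>)"
  by simp

lemma ideal_base_ring_add:
  assumes "ideal J (base_ring \<Gamma>)" "p \<in> J" "q \<in> J"
  shows "p + q \<in> J"
  using additive_subgroup.a_closed[OF ideal.axioms(1)[OF assms(1)] assms(2,3)] by simp

lemma ideal_base_ring_zero:
  assumes "ideal J (base_ring \<Gamma>)"
  shows "0 \<in> J"
  using additive_subgroup.zero_closed[OF ideal.axioms(1)[OF assms]] by simp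

lemma ideal_base_ring_mult_single:
  assumes "ideal J (base_ring \<Gamma>)" "p \<in> J" "M \<in> base_monomials \<Gamma>"
  shows "Poly_Mapping.single M c * p \<in> J"
  using ideal.I_l_closed[OF assms(1,2) single_in_base_ring[OF assms(3), of c]] by simp

lemma ideal_base_ring_uminus:
  assumes "ideal J (base_ring \<Gamma>)" "p \<in> J"
  shows "- p \<in> J"
  using ideal_base_ring_mult_single[OF assms base_monomials_closed(1), of "-1"]
  by (simp add: single_uminus)

lemma ideal_base_ring_sum:
  assumes "ideal J (base_ring \<Gamma>)" "\<And>x. x \<in> A \<Longrightarrow> g x \<in> J"
  shows "(\<Sum>x\<in>A. g x) \<in> J"
  using assms(2)
  by (induction A rule: infinite_finite_induct)
    (auto intro: ideal_base_ring_zero[OF assms(1)] ideal_base_ring_add[OF assms(1)])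

lemma ideal_toric_ideal: "ideal (toric_ideal \<Gamma>) (base_ring \<Gamma>)"
proof -
  interpret R: cring "base_ring \<Gamma>" by (rule cring_base_ring)
  \<comment> \<open>The record fixes only addition; uniqueness of additive inverses identifies its
    negation with that of polynomials.\<close>
  have uminus: "\<ominus>\<^bsub>base_ring \<Gamma>\<^esub> p = - p" if "p \<in> carrier (base_ring \<Gamma>)" for p
  proof (rule R.minus_equality)
    have "Poly_Mapping.keys (- p) = Poly_Mapping.keys p"
      by (auto simp: in_keys_iff)
    with that show "- p \<in> carrier (base_ring \<Gamma>)" by simp
  qed (use that in simp_all)
  have mult: "q \<otimes>\<^bsub>base_ring \<Gamma>\<^esub> p \<in> toric_ideal \<Gamma>"
    if "p \<in> toric_ideal \<Gamma>" "q \<in> carrier (base_ring \<Gamma>)" for p q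
    using that R.m_closed[of q p]
    by (simp add: toric_ideal_def toric_map_eq_push push_mult toric_exponent_add)
  show ?thesis
  proof (rule idealI[OF R.ring_axioms])
    show "subgroup (toric_ideal \<Gamma>) (add_monoid (base_ring \<Gamma>))"
    proof (rule subgroup.intro)
      fix p q
      assume "p \<in> toric_ideal \<Gamma>" "q \<in> toric_ideal \<Gamma>"
      then show "p \<otimes>\<^bsub>add_monoid (base_ring \<Gamma>)\<^esub> q \<in> toric_ideal \<Gamma>"
        using R.a_closed[of p q] by (simp add: toric_ideal_def toric_map_eq_push push_add)
    next
      fix p
      assume p: "p \<in> toric_ideal \<Gamma>"
      then have "p \<in> carrier (base_ring \<Gamma>)" by (simp add: toric_ideal_def)
      with p show "inv\<^bsub>add_monoid (base_ring \<Gamma>)\<^esub> p \<in> toric_ideal \<Gamma>"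
        using R.a_inv_closed[of p] uminus[of p]
        by (simp add: toric_ideal_def toric_map_eq_push push_uminus a_inv_def)
    qed (auto simp: toric_ideal_def toric_map_eq_push)
  qed (use mult in \<open>auto simp: R.m_comm mult.commute\<close>)
qed

section \<open>Exchange binomials\<close>

text \<open>Add the two equations defining the exchange and cancel
  \<open>indet i + indet j\<close>.\<close>

lemma symmetric_exchange_sum:
  assumes "symmetric_exchange \<Gamma> m m' n n'"
  shows "m + m' = n + n'"
proof -
  obtain i j where ij: "indet i + n = indet j + m" "indet j + n' = indet i + m'"
    using assms unfolding symmetric_exchange_def by blast
  have "(indet i + n) + (indet j + n') = (indet j + m) + (indet i + m')"
    by (simp only: ij)
  then have "(indet i + indet j) + (m + m') = (indet i + indet j) + (n + n')"
    by (simp only: ac_simps)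
  then show ?thesis by (simp only: add_left_cancel)
qed

lemma exchange_binomials_subset_toric_ideal: "exchange_binomials \<Gamma> \<subseteq> toric_ideal \<Gamma>"
proof
  fix p assume "p \<in> exchange_binomials \<Gamma>"
  then obtain m m' n n' where
    p: "p = poly_monom (indet m + indet m') - poly_monom (indet n + indet n')"
    and ex: "symmetric_exchange \<Gamma> m m' n n'"
    unfolding exchange_binomials_def by blast
  have "indet m + indet m' \<in> base_monomials \<Gamma>" "indet n + indet n' \<in> base_monomials \<Gamma>"
    using ex unfolding collection_monomial_pair[symmetric] collection_monomial_in_base_monomials
    by (simp_all add: symmetric_exchange_def)
  then have "Poly_Mapping.keys p \<subseteq> base_monomials \<Gamma>"
    using keys_diff[of "poly_monom (indet m + indet m')" "poly_monom (indet n + indet n')"]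
    by (auto simp: p)
  moreover have "toric_map p = 0"
    using symmetric_exchange_sum[OF ex]
    unfolding p toric_map_eq_push push_diff collection_monomial_pair[symmetric] by simp
  ultimately show "p \<in> toric_ideal \<Gamma>" by (simp add: toric_ideal_def)
qed

lemma finite_exchange_binomials:
  assumes "discrete_polymatroid \<Gamma>"
  shows "finite (exchange_binomials \<Gamma>)"
proof (rule finite_subset)
  have "finite (bases \<Gamma>)"
    using assms by (simp add: discrete_polymatroid_def bases_def)
  then show "finite ((\<lambda>(m, m', n, n'). poly_monom (indet m + indet m') - poly_monom (indet n + indet n'))
      ` (bases \<Gamma> \<times> bases \<Gamma> \<times> bases \<Gamma> \<times> bases \<Gamma>) :: nat monomial cpoly set)"
    by blast
  show "exchange_binomials \<Gamma> \<subseteq> (\<lambda>(m, m', n, n'). poly_monom (indet m + indet m')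
      - poly_monom (indet n + indet n')) ` (bases \<Gamma> \<times> bases \<Gamma> \<times> bases \<Gamma> \<times> bases \<Gamma>)"
    by (auto simp: exchange_binomials_def symmetric_exchange_def image_iff) blast
qed

section \<open>Leading monomials\<close>

text \<open>Induction over a finite nonempty set of monomials gives a maximum, and irreflexivity
  with transitivity makes it unique, so the definite description in \<open>leading_monomial\<close>
  denotes it.\<close>

lemma leading_monomial_props:
  assumes "monomial_order \<Gamma> gt" "p \<in> carrier (base_ring \<Gamma>)" "p \<noteq> 0"
  shows "leading_monomial gt p \<in> Poly_Mapping.keys p"
    and "\<And>N. N \<in> Poly_Mapping.keys p \<Longrightarrow> N \<noteq> leading_monomial gt p \<Longrightarrow> gt (leading_monomial gt p) N"
proof -
  let ?P = "\<lambda>A M. M \<in> A \<and> (\<forall>N\<in>A. N \<noteq> M \<longrightarrow> gt M N)"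
  have irrefl: "irreflp_on (base_monomials \<Gamma>) gt" and trans: "transp_on (base_monomials \<Gamma>) gt"
    and total: "totalp_on (base_monomials \<Gamma>) gt"
    using assms(1) by (auto simp: monomial_order_def)
  have max: "\<exists>M. ?P A M" if "finite A" "A \<noteq> {}" "A \<subseteq> base_monomials \<Gamma>" for A
    using that
  proof (induction A rule: finite_ne_induct)
    case (insert x A)
    then obtain M where M: "?P A M" by auto
    have xM: "gt x M \<or> gt M x"
      using total insert.hyps insert.prems M by (metis insert_subset subset_iff totalp_onD)
    show ?case
    proof (cases "gt x M")
      case True
      have "?P (insert x A) x"
        using True M insert.prems transp_onD[OF trans, of x M] by (metis insert_iff subset_iff)
      then show ?thesis by blast
    qed (use xM M in auto)
  qed auto
  have "\<exists>!M. ?P (Poly_Mapping.keys p) M"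
  proof (rule ex_ex1I)
    show "\<exists>M. ?P (Poly_Mapping.keys p) M"
      using assms(2,3) by (intro max) auto
  next
    fix M N assume *: "?P (Poly_Mapping.keys p) M" "?P (Poly_Mapping.keys p) N"
    then have "M \<in> base_monomials \<Gamma>" "N \<in> base_monomials \<Gamma>"
      using assms(2) by auto
    with * show "M = N"
      using irreflp_onD[OF irrefl, of M] transp_onD[OF trans, of M N M] by metis
  qed
  from theI'[OF this] show "leading_monomial gt p \<in> Poly_Mapping.keys p"
    and "\<And>N. N \<in> Poly_Mapping.keys p \<Longrightarrow> N \<noteq> leading_monomial gt p \<Longrightarrow> gt (leading_monomial gt p) N"
    by (auto simp: leading_monomial_def)
qed

section \<open>Arcs of the directed graph as multiples of exchange binomials\<close>

text \<open>\<open>U\<close> holds the untouched bases, \<open>b\<close> and \<open>c\<close> the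
  exchanged pairs. The equality of sizes is recorded because it later confines reduction to finitely
  many collections.\<close>

lemma exchange_step_binomial:
  assumes "exchange_step \<Gamma> V W"
  obtains U b c where "V = U + b" "W = U + c" "size b = size c"
    "set_mset b \<subseteq> bases \<Gamma>" "set_mset c \<subseteq> bases \<Gamma>"
    "poly_monom (collection_monomial b) - poly_monom (collection_monomial c)
      \<in> exchange_binomials \<Gamma>"
proof -
  obtain U m m' n n' where ex: "symmetric_exchange \<Gamma> m m' n n'"
    and "V = U + {#m, m'#}" "W = U + {#n, n'#}"
    using assms unfolding exchange_step_def by blast
  moreover have "poly_monom (collection_monomial {#m, m'#}) - poly_monom (collection_monomial {#n, n'#})
      \<in> exchange_binomials \<Gamma>"
    using ex unfolding exchange_binomials_def collection_monomial_pair by blast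
  ultimately show thesis
    by (intro that[of U "{#m, m'#}" "{#n, n'#}"]) (auto simp: symmetric_exchange_def)
qed

text \<open>An arc is directed by the order and may run against the exchange that produced its edge;
  the binomial then occurs with the opposite sign.\<close>

lemma digraph_arc_binomial:
  assumes "digraph_arc \<Gamma> gt \<mu> V W"
  obtains U b c where "V = U + b" "W = U + c" "size b = size c"
    "set_mset b \<subseteq> bases \<Gamma>" "set_mset c \<subseteq> bases \<Gamma>"
    "poly_monom (collection_monomial b) - poly_monom (collection_monomial c)
      \<in> exchange_binomials \<Gamma> \<union> uminus ` exchange_binomials \<Gamma>"
proof -
  have "exchange_step \<Gamma> V W \<or> exchange_step \<Gamma> W V"
    using assms by (auto simp: digraph_arc_def graph_adjacent_def)
  then show thesis
  proof
    assume "exchange_step \<Gamma> V W"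
    then show thesis
      by (rule exchange_step_binomial) (rule that; auto)
  next
    assume "exchange_step \<Gamma> W V"
    then show thesis
    proof (rule exchange_step_binomial)
      fix U b c
      assume *: "W = U + b" "V = U + c" "size b = size c"
        "set_mset b \<subseteq> bases \<Gamma>" "set_mset c \<subseteq> bases \<Gamma>"
        "poly_monom (collection_monomial b) - poly_monom (collection_monomial c)
          \<in> exchange_binomials \<Gamma>"
      have "poly_monom (collection_monomial c) - poly_monom (collection_monomial b)
          \<in> uminus ` exchange_binomials \<Gamma>"
        by (rule image_eqI[OF _ *(6)]) simp
      with * show thesis by (intro that[of U c b]) auto
    qed
  qed
qed

text \<open>The difference is the monomial of the common part \<open>U\<close> times an exchange
  binomial, up to sign.\<close>

lemma digraph_arc_diff_in_ideal:
  assumes "digraph_arc \<Gamma> gt \<mu> V W"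
    and J: "ideal J (base_ring \<Gamma>)" "exchange_binomials \<Gamma> \<subseteq> J"
  shows "poly_monom (collection_monomial V) - poly_monom (collection_monomial W) \<in> J"
proof -
  obtain U b c where V: "V = U + b" and W: "W = U + c"
    and bin: "poly_monom (collection_monomial b) - poly_monom (collection_monomial c)
      \<in> exchange_binomials \<Gamma> \<union> uminus ` exchange_binomials \<Gamma>" (is "?q \<in> _")
    by (rule digraph_arc_binomial[OF assms(1)])
  have U: "collection_monomial U \<in> base_monomials \<Gamma>"
    using assms(1) V
    by (auto simp: digraph_arc_def graph_adjacent_def graph_vertices_def
        collection_monomial_in_base_monomials)
  have "?q \<in> J"
    using bin
  proof
    assume "?q \<in> uminus ` exchange_binomials \<Gamma>"
    then obtain q where "?q = - q" "q \<in> exchange_binomials \<Gamma>" by (rule imageE)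
    with J(2) show ?thesis by (auto intro: ideal_base_ring_uminus[OF J(1)])
  qed (use J(2) in auto)
  from ideal_base_ring_mult_single[OF J(1) this U, of 1] show ?thesis
    by (simp add: V W collection_monomial_add right_diff_distrib mult_single)
qed

text \<open>Cancelling the common factor \<open>N\<close> preserves the comparison along the arc, so
  \<open>B\<close> is the leading monomial of the exchange binomial, and it divides the monomial of
  \<open>V\<close>.\<close>

lemma digraph_arc_leading_in_initial_ideal:
  assumes arc: "digraph_arc \<Gamma> gt \<mu> V W" and ord: "monomial_order \<Gamma> gt"
  shows "poly_monom (collection_monomial V) \<in> initial_ideal \<Gamma> gt (exchange_binomials \<Gamma>)"
proof -
  interpret R: ring "base_ring \<Gamma>" by (rule ring_base_ring)
  have irrefl: "irreflp_on (base_monomials \<Gamma>) gt" and trans: "transp_on (base_monomials \<Gamma>) gt"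
    and total: "totalp_on (base_monomials \<Gamma>) gt"
    and compat: "\<And>M M' N. M \<in> base_monomials \<Gamma> \<Longrightarrow> M' \<in> base_monomials \<Gamma> \<Longrightarrow>
      N \<in> base_monomials \<Gamma> \<Longrightarrow> gt M M' \<Longrightarrow> gt (M + N) (M' + N)"
    using ord by (auto simp: monomial_order_def)
  obtain U b c where V: "V = U + b" and W: "W = U + c"
    and b: "set_mset b \<subseteq> bases \<Gamma>" and c: "set_mset c \<subseteq> bases \<Gamma>"
    and bin: "poly_monom (collection_monomial b) - poly_monom (collection_monomial c)
      \<in> exchange_binomials \<Gamma> \<union> uminus ` exchange_binomials \<Gamma>"
    by (rule digraph_arc_binomial[OF arc])
  define B C N where BCN: "B = collection_monomial b" "C = collection_monomial c"
    "N = collection_monomial U"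
  have mem: "B \<in> base_monomials \<Gamma>" "C \<in> base_monomials \<Gamma>" "N \<in> base_monomials \<Gamma>"
    using arc V b c
    by (auto simp: BCN digraph_arc_def graph_adjacent_def graph_vertices_def
        collection_monomial_in_base_monomials)
  have gtVW: "gt (B + N) (C + N)" and "V \<noteq> W"
    using arc by (auto simp: digraph_arc_def graph_adjacent_def V W BCN collection_monomial_add
        add.commute)
  then have BC: "B \<noteq> C" using V W BCN by auto
  \<comment> \<open>Compatibility with products only goes upwards; cancellation follows by totality,
    as \<open>gt C B\<close> would give the reverse of \<open>gtVW\<close>.\<close>
  have gtBC: "gt B C"
  proof (rule ccontr)
    assume "\<not> gt B C"
    with total mem BC have "gt C B" by (auto dest: totalp_onD)
    from compat[OF mem(2,1,3) this] gtVW show False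
      using irreflp_onD[OF irrefl] transp_onD[OF trans] base_monomials_closed(2) mem by metis
  qed
  obtain q where q: "q \<in> exchange_binomials \<Gamma>"
    and q': "q = poly_monom B - poly_monom C \<or> q = - (poly_monom B - poly_monom C)"
    using bin unfolding BCN by (metis UnE imageE minus_minus)
  \<comment> \<open>The support does not see the sign of \<open>q\<close>, which settles both
    orientations of the exchange at once; \<open>B \<noteq> C\<close> prevents cancellation.\<close>
  have keys: "Poly_Mapping.keys q = {B, C}"
    using q' BC by (auto simp: in_keys_iff lookup_minus lookup_single when_def split: if_splits)
  then have "q \<noteq> 0" by auto
  have "leading_monomial gt q = B"
    using leading_monomial_props[OF ord _ \<open>q \<noteq> 0\<close>] keys mem gtBC irreflp_onD[OF irrefl, of B]
      transp_onD[OF trans, of B C B] BC by force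
  then have "poly_monom B \<in> (\<lambda>p. poly_monom (leading_monomial gt p)) ` (exchange_binomials \<Gamma> - {0})"
    using q \<open>q \<noteq> 0\<close> by force
  moreover have "(\<lambda>p. poly_monom (leading_monomial gt p)) ` (exchange_binomials \<Gamma> - {0})
      \<subseteq> carrier (base_ring \<Gamma>)"
    using leading_monomial_props(1)[OF ord] exchange_binomials_subset_toric_ideal[of \<Gamma>]
    by (fastforce simp: toric_ideal_def)
  ultimately have "poly_monom B \<in> initial_ideal \<Gamma> gt (exchange_binomials \<Gamma>)"
    and "ideal (initial_ideal \<Gamma> gt (exchange_binomials \<Gamma>)) (base_ring \<Gamma>)"
    using R.genideal_self R.genideal_ideal unfolding initial_ideal_def by blast+
  from ideal_base_ring_mult_single[OF this(2,1) mem(3), of 1] show ?thesis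
    by (simp add: V BCN collection_monomial_add mult_single)
qed

section \<open>Reduction to a sink\<close>

text \<open>Follow arcs until none leaves. Arcs preserve the size of a collection and there are
  finitely many bases, so termination follows from finiteness, by counting the smaller collections,
  and not from well-foundedness of the order.\<close>

lemma reduces_to_sink:
  assumes "discrete_polymatroid \<Gamma>" and ord: "monomial_order \<Gamma> gt"
    and J: "ideal J (base_ring \<Gamma>)" "exchange_binomials \<Gamma> \<subseteq> J"
    and "V \<in> graph_vertices \<Gamma> \<mu>"
  obtains W where "digraph_sink \<Gamma> gt \<mu> W"
    "W = V \<or> gt (collection_monomial V) (collection_monomial W)"
    "poly_monom (collection_monomial V) - poly_monom (collection_monomial W) \<in> J"
proof -
  have irrefl: "irreflp_on (base_monomials \<Gamma>) gt" and trans: "transp_on (base_monomials \<Gamma>) gt"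
    using ord by (auto simp: monomial_order_def)
  have fin: "finite (multisets_of_size (bases \<Gamma>) n)" for n
    using assms(1) by (intro finite_multisets_of_size) (simp add: discrete_polymatroid_def bases_def)
  let ?S = "\<lambda>V. {W \<in> multisets_of_size (bases \<Gamma>) (size V).
    gt (collection_monomial V) (collection_monomial W)}"
  have "\<exists>W. digraph_sink \<Gamma> gt \<mu> W \<and>
      (W = V \<or> gt (collection_monomial V) (collection_monomial W)) \<and>
      poly_monom (collection_monomial V) - poly_monom (collection_monomial W) \<in> J"
    using assms(5)
  proof (induction "card (?S V)" arbitrary: V rule: less_induct)
    case less
    show ?case
    proof (cases "digraph_sink \<Gamma> gt \<mu> V")
      case True
      then show ?thesis using ideal_base_ring_zero[OF J(1)] by auto
    next
      case False
      with less.prems obtain X where arc: "digraph_arc \<Gamma> gt \<mu> V X"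
        unfolding digraph_sink_def by blast
      then have X: "X \<in> graph_vertices \<Gamma> \<mu>" and gtVX: "gt (collection_monomial V) (collection_monomial X)"
        by (auto simp: digraph_arc_def graph_adjacent_def)
      have size: "size X = size V"
        by (rule digraph_arc_binomial[OF arc]) simp
      have base: "collection_monomial Y \<in> base_monomials \<Gamma>"
        if "Y \<in> graph_vertices \<Gamma> \<mu> \<or> Y \<in> multisets_of_size (bases \<Gamma>) n" for Y n
        using that
        by (auto simp: graph_vertices_def multisets_of_size_def collection_monomial_in_base_monomials)
      \<comment> \<open>Since \<open>X\<close> and \<open>V\<close> have equal size, both sets are
        cut from the same finite set. Transitivity gives inclusion, and \<open>X\<close> itself,
        below \<open>V\<close> but not below \<open>X\<close>, makes it strict.\<close>
      have "?S X \<subset> ?S V"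
      proof
        show "?S X \<subseteq> ?S V"
          using transp_onD[OF trans] base less.prems X gtVX size by auto blast
        have "X \<in> ?S V"
          using X size gtVX by (auto simp: multisets_of_size_def graph_vertices_def)
        moreover have "X \<notin> ?S X"
          using irreflp_onD[OF irrefl] base X by auto
        ultimately show "?S X \<noteq> ?S V" by blast
      qed
      then have "card (?S X) < card (?S V)"
        using fin by (intro psubset_card_mono) auto
      from less.hyps[OF this X] obtain W where W: "digraph_sink \<Gamma> gt \<mu> W"
        "W = X \<or> gt (collection_monomial X) (collection_monomial W)"
        "poly_monom (collection_monomial X) - poly_monom (collection_monomial W) \<in> J"
        by blast
      have "W \<in> graph_vertices \<Gamma> \<mu>" using W(1) by (simp add: digraph_sink_def)
      then have "gt (collection_monomial V) (collection_monomial W)"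
        using W(2) gtVX transp_onD[OF trans] base less.prems X by blast
      \<comment> \<open>Telescoping: the difference over the first arc plus the difference from the
        induction hypothesis.\<close>
      moreover have "poly_monom (collection_monomial V) - poly_monom (collection_monomial W) \<in> J"
        using ideal_base_ring_add[OF J(1) digraph_arc_diff_in_ideal[OF arc J] W(3)] by simp
      ultimately show ?thesis using W(1) by blast
    qed
  qed
  then show thesis using that by blast
qed

theorem theorem2p10:
  fixes \<Gamma> :: "nat monomial set"
    and gt :: "nat monomial monomial \<Rightarrow> nat monomial monomial \<Rightarrow> bool"
  assumes "discrete_polymatroid \<Gamma>"
    and "monomial_order \<Gamma> gt"
    and "\<And>\<mu>. graph_vertices \<Gamma> \<mu> \<noteq> {} \<Longrightarrow> \<exists>!V. digraph_sink \<Gamma> gt \<mu> V"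
  shows "toric_ideal \<Gamma> = Idl\<^bsub>base_ring \<Gamma>\<^esub> (exchange_binomials \<Gamma>) \<and>
    groebner_basis \<Gamma> gt (toric_ideal \<Gamma>) (exchange_binomials \<Gamma>)"
proof -
  interpret R: ring "base_ring \<Gamma>" by (rule ring_base_ring)
  let ?G = "exchange_binomials \<Gamma>"
  define J where "J = Idl\<^bsub>base_ring \<Gamma>\<^esub> ?G"
  have carrier: "toric_ideal \<Gamma> \<subseteq> carrier (base_ring \<Gamma>)"
    by (auto simp: toric_ideal_def)
  then have "?G \<subseteq> carrier (base_ring \<Gamma>)"
    using exchange_binomials_subset_toric_ideal by blast
  then have J: "ideal J (base_ring \<Gamma>)" "?G \<subseteq> J"
    unfolding J_def by (simp_all only: R.genideal_ideal R.genideal_self)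
  \<comment> \<open>The normal form attached to a fibre. It is evaluated only at exponents of
    monomials of the base ring, where the graph is nonempty and the description denotes its unique
    sink.\<close>
  define s where "s \<mu> = collection_monomial (THE V. digraph_sink \<Gamma> gt \<mu> V)" for \<mu>
  have s: "(s (toric_exponent M) = M \<or> gt M (s (toric_exponent M))) \<and>
      poly_monom M - poly_monom (s (toric_exponent M)) \<in> J"
    if "M \<in> base_monomials \<Gamma>" for M
  proof -
    have V: "collection_of M \<in> graph_vertices \<Gamma> (toric_exponent M)"
      using that by (simp add: collection_of_in_graph_vertices)
    then obtain W where W: "digraph_sink \<Gamma> gt (toric_exponent M) W"
      "W = collection_of M \<or> gt M (collection_monomial W)"
      "poly_monom M - poly_monom (collection_monomial W) \<in> J"
      using reduces_to_sink[OF assms(1,2) J V] by (metis collection_monomial_collection_of)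
    moreover have "(THE V. digraph_sink \<Gamma> gt (toric_exponent M) V) = W"
      using assms(3)[of "toric_exponent M"] V W(1) by (intro the1_equality) auto
    ultimately show ?thesis by (auto simp: s_def)
  qed
  have "toric_ideal \<Gamma> \<subseteq> J"
  proof
    fix p assume p: "p \<in> toric_ideal \<Gamma>"
    then have keys: "Poly_Mapping.keys p \<subseteq> base_monomials \<Gamma>" and "push toric_exponent p = 0"
      by (simp_all add: toric_ideal_def toric_map_eq_push)
    \<comment> \<open>The normal form of a monomial depends only on its fibre, so passing to normal
      forms factors through \<open>\<phi>\<close> and sends \<open>p\<close> to zero.\<close>
    then have "push (s \<circ> toric_exponent) p = 0"
      by (simp flip: push_push)
    \<comment> \<open>Subtracting this zero exhibits \<open>p\<close> as a linear combination of
      differences between monomials and their normal forms, each of which lies in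
      \<open>J\<close>.\<close>
    then have "p = push (\<lambda>M. M) p - push (s \<circ> toric_exponent) p"
      by (simp add: push_id)
    also have "\<dots> = (\<Sum>M\<in>Poly_Mapping.keys p. Poly_Mapping.single 0 (Poly_Mapping.lookup p M) *
        (poly_monom M - poly_monom (s (toric_exponent M))))"
      by (simp add: push_def right_diff_distrib mult_single sum_subtractf)
    also have "\<dots> \<in> J"
      using keys s
      by (intro ideal_base_ring_sum[OF J(1)] ideal_base_ring_mult_single[OF J(1)]
          base_monomials_closed(1)) auto
    finally show "p \<in> J" .
  qed
  moreover have "J \<subseteq> toric_ideal \<Gamma>"
    unfolding J_def
    by (rule R.genideal_minimal[OF ideal_toric_ideal exchange_binomials_subset_toric_ideal])
  moreover have "initial_ideal \<Gamma> gt (toric_ideal \<Gamma>) = initial_ideal \<Gamma> gt ?G"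
  proof
    have lm: "(\<lambda>p. poly_monom (leading_monomial gt p)) ` (toric_ideal \<Gamma> - {0})
        \<subseteq> carrier (base_ring \<Gamma>)"
      using leading_monomial_props(1)[OF assms(2)] carrier by fastforce
    have lm': "(\<lambda>p. poly_monom (leading_monomial gt p)) ` (?G - {0})
        \<subseteq> (\<lambda>p. poly_monom (leading_monomial gt p)) ` (toric_ideal \<Gamma> - {0})"
      using exchange_binomials_subset_toric_ideal by blast
    show "initial_ideal \<Gamma> gt ?G \<subseteq> initial_ideal \<Gamma> gt (toric_ideal \<Gamma>)"
      unfolding initial_ideal_def
      by (rule R.genideal_minimal[OF R.genideal_ideal[OF lm] order_trans[OF lm' R.genideal_self[OF lm]]])
    have id: "ideal (initial_ideal \<Gamma> gt ?G) (base_ring \<Gamma>)"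
      unfolding initial_ideal_def by (rule R.genideal_ideal[OF order_trans[OF lm' lm]])
    have "poly_monom (leading_monomial gt p) \<in> initial_ideal \<Gamma> gt ?G"
      if p: "p \<in> toric_ideal \<Gamma>" "p \<noteq> 0" for p
    proof -
      define M where "M = leading_monomial gt p"
      have keys: "Poly_Mapping.keys p \<subseteq> base_monomials \<Gamma>" and push: "push toric_exponent p = 0"
        using p(1) by (simp_all add: toric_ideal_def toric_map_eq_push)
      have M: "M \<in> Poly_Mapping.keys p"
        and gtM: "\<And>N. N \<in> Poly_Mapping.keys p \<Longrightarrow> N \<noteq> M \<Longrightarrow> gt M N"
        using leading_monomial_props[OF assms(2) _ p(2)] keys by (auto simp: M_def)
      obtain N where N: "N \<in> Poly_Mapping.keys p" "N \<noteq> M" "toric_exponent N = toric_exponent M"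
        by (rule push_eq_0_other_key[OF push M])
      have MN: "M \<in> base_monomials \<Gamma>" "N \<in> base_monomials \<Gamma>"
        using M N(1) keys by auto
      \<comment> \<open>\<open>N\<close> has the same normal form as \<open>M\<close>. If that were
        \<open>M\<close>, then \<open>N = M\<close> or \<open>gt N M\<close>, against
        \<open>N \<noteq> M\<close> and \<open>gt M N\<close>.\<close>
      have "s (toric_exponent M) \<noteq> M"
        using s[OF MN(2)] N gtM[OF N(1,2)] MN assms(2) unfolding monomial_order_def
        by (metis irreflp_onD transp_onD)
      \<comment> \<open>By uniqueness, a sink at \<open>M\<close> would be the one selected by
        \<open>s\<close>.\<close>
      then have "\<not> digraph_sink \<Gamma> gt (toric_exponent M) (collection_of M)"
        using assms(3)[of "toric_exponent M"] MN(1)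
        by (metis collection_monomial_collection_of digraph_sink_def empty_iff s_def the1_equality)
      then obtain W where "digraph_arc \<Gamma> gt (toric_exponent M) (collection_of M) W"
        using MN(1) collection_of_in_graph_vertices[of M \<Gamma> "toric_exponent M"]
        unfolding digraph_sink_def by blast
      from digraph_arc_leading_in_initial_ideal[OF this assms(2)] show ?thesis
        by (simp add: M_def)
    qed
    then show "initial_ideal \<Gamma> gt (toric_ideal \<Gamma>) \<subseteq> initial_ideal \<Gamma> gt ?G"
      unfolding initial_ideal_def[of \<Gamma> gt "toric_ideal \<Gamma>"]
      by (intro R.genideal_minimal[OF id]) auto
  qed
  ultimately show ?thesis
    using finite_exchange_binomials[OF assms(1)] exchange_binomials_subset_toric_ideal[of \<Gamma>]
    by (auto simp: groebner_basis_def J_def)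
qed

end
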